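(* Let $m,n\ge 1$ be integers and let $A\in\mathbb{M}_m(\mathbb{M}_n)$ be PPT. Then \[ \boldsymbol{\lambda}(A)\prec\boldsymbol{\lambda}(\mathrm{tr}_1 A)\quad\text{and}\quad \boldsymbol{\lambda}(A)\prec\boldsymbol{\lambda}(\mathrm{tr}_2 A). \] Similarly, \[ \boldsymbol{\lambda}(A^{\tau})\prec\boldsymbol{\lambda}(\mathrm{tr}_1 A)\quad\text{and}\quad \boldsymbol{\lambda}(A^{\tau})\prec\boldsymbol{\lambda}(\mathrm{tr}_2 A). \]
   Context: $\mathbb{M}_n$ is the space of $n\times n$ complex matrices. $\mathbb{M}_m(\mathbb{M}_n)$ is the set of $m\times m$ block matrices $A=[A_{i,j}]_{i,j=1}^m$ with blocks $A_{i,j}\in\mathbb{M}_n$, regarded also as $mn\times mn$ complex matrices. The partial transpose of $A$ is $A^{\tau}=[A_{j,i}]_{i,j=1}^m$ (the blocks themselves are not transposed). $A$ is PPT (positive partial transpose) if both $A$ and $A^\tau$ are positive semidefinite. The partial traces are $\mathrm{tr}_1 A=\sum_{i=1}^m A_{i,i}\in\mathbb{M}_n$ and $\mathrm{tr}_2 A=[\mathrm{tr}\,A_{i,j}]_{i,j=1}^m\in\mathbb{M}_m$, where $\mathrm{tr}$ is the usual trace. For Hermitian $H$, $\boldsymbol{\lambda}(H)$ is the vector of eigenvalues of $H$ (with multiplicity) in decreasing order. For $\boldsymbol{x},\boldsymbol{y}\in\mathbb{R}^N$, with $x_1^{\downarrow}\ge\cdots\ge x_N^{\downarrow}$ denoting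 the non-increasing rearrangement, $\boldsymbol{x}\prec\boldsymbol{y}$ ($\boldsymbol{x}$ is majorized by $\boldsymbol{y}$) means $\sum_{i=1}^k x_i^{\downarrow}\le\sum_{i=1}^k y_i^{\downarrow}$ for $k=1,\ldots,N$, with equality for $k=N$. If $\boldsymbol{x}$ has larger dimension than $\boldsymbol{y}$, then $\boldsymbol{x}\prec\boldsymbol{y}$ means $\boldsymbol{x}\prec(\boldsymbol{y},\boldsymbol{0})$, where zeros are appended to $\boldsymbol{y}$ to make the dimensions equal. *)

theory Defs
  imports
    "Jordan_Normal_Form.Schur_Decomposition"
    "HOL-Computational_Algebra.Fundamental_Theorem_Algebra"
begin

section \<open>Positive semidefinite matrices and eigenvalues\<close>

definition hermitian :: "complex mat \<Rightarrow> bool" where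
  "hermitian A \<longleftrightarrow> square_mat A \<and> mat_adjoint A = A"

(* The order on complex numbers is the library's partial order: 0 \<le> z means that z is
   real and nonnegative. *)
definition psd :: "complex mat \<Rightarrow> bool" where
  "psd A \<longleftrightarrow> hermitian A \<and> (\<forall>v \<in> carrier_vec (dim_row A). 0 \<le> (A *\<^sub>v v) \<bullet>c v)"

definition mat_trace :: "complex mat \<Rightarrow> complex" where
  "mat_trace A = (\<Sum>i<dim_row A. A $$ (i, i))"

definition decreasing :: "real list \<Rightarrow> real list" where
  "decreasing xs = rev (sort xs)"

(* Eigenvalues are listed with algebraic multiplicity. The definition is meant for Hermitian
   matrices, where taking real parts loses nothing (hermitian_eigvals below). *)
definition eigvals :: "complex mat \<Rightarrow> real list" where
  "eigvals H = rev (sorted_list_of_multiset (image_mset Re (proots (char_poly H))))"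

lemma length_eigvals:
  assumes "H \<in> carrier_mat N N"
  shows "length (eigvals H) = N"
proof -
  have "length (eigvals H) = size (mset (eigvals H))" by simp
  also have "\<dots> = size (proots (char_poly H))" by (simp add: eigvals_def)
  also have "\<dots> = N" using degree_monic_char_poly[OF assms] by (simp add: size_proots_complex)
  finally show ?thesis .
qed

lemma hermitian_eigenvalue_real:
  assumes "hermitian H" and "eigenvalue H c"
  shows "Im c = 0"
proof -
  define N where "N = dim_row H"
  have H: "H \<in> carrier_mat N N" using assms(1) by (auto simp: hermitian_def N_def)
  obtain v where v: "v \<in> carrier_vec N" "v \<noteq> 0\<^sub>v N" "H *\<^sub>v v = c \<cdot>\<^sub>v v"
    using assms(2) by (auto simp: eigenvalue_def eigenvector_def N_def)
  have ent: "cnj (H $$ (j, i)) = H $$ (i, j)" if "i < N" "j < N" for i j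
  proof -
    have "H $$ (i, j) = mat_adjoint H $$ (i, j)" using assms(1) by (simp add: hermitian_def)
    also have "\<dots> = cnj (H $$ (j, i))" using that H by (simp add: mat_adjoint_def mat_of_rows_def)
    finally show ?thesis by simp
  qed
  have exp: "(H *\<^sub>v v) \<bullet>c v = (\<Sum>i<N. \<Sum>j<N. H $$ (i, j) * v $ j * cnj (v $ i))"
    using H v(1) by (simp add: scalar_prod_def sum_distrib_right atLeast0LessThan)
  have "cnj ((H *\<^sub>v v) \<bullet>c v) = (\<Sum>i<N. \<Sum>j<N. H $$ (j, i) * cnj (v $ j) * v $ i)"
    unfolding exp by (simp add: ent)
  also have "\<dots> = (\<Sum>j<N. \<Sum>i<N. H $$ (j, i) * cnj (v $ j) * v $ i)" by (rule sum.swap)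
  also have "\<dots> = (H *\<^sub>v v) \<bullet>c v" unfolding exp by (simp add: mult.commute mult.left_commute)
  finally have r: "cnj ((H *\<^sub>v v) \<bullet>c v) = (H *\<^sub>v v) \<bullet>c v" .
  have e: "(H *\<^sub>v v) \<bullet>c v = c * (v \<bullet>c v)" using v by simp
  have nz: "v \<bullet>c v \<noteq> 0" using v by simp
  have "v \<bullet>c v \<ge> 0" using v by (simp add: conjugate_square_ge_0_vec)
  then have "cnj (v \<bullet>c v) = v \<bullet>c v" by (simp add: less_eq_complex_def complex_eq_iff)
  with r e nz have "cnj c = c" by (simp del: conjugate_square_eq_0_vec)
  then show ?thesis by (simp add: complex_eq_iff)
qed

lemma hermitian_eigvals:
  assumes "hermitian H"
  shows "image_mset complex_of_real (mset (eigvals H)) = proots (char_poly H)"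
proof -
  have H: "H \<in> carrier_mat (dim_row H) (dim_row H)" using assms by (auto simp: hermitian_def)
  have nz: "char_poly H \<noteq> 0" using degree_monic_char_poly[OF H] by auto
  have "complex_of_real (Re c) = c" if "c \<in># proots (char_poly H)" for c
    using that nz hermitian_eigenvalue_real[OF assms] eigenvalue_root_char_poly[OF H]
    by (simp add: complex_eq_iff)
  then have "image_mset (\<lambda>c. complex_of_real (Re c)) (proots (char_poly H)) = proots (char_poly H)"
    using image_mset_cong[of "proots (char_poly H)" "\<lambda>c. complex_of_real (Re c)" id] by simp
  then show ?thesis by (simp add: eigvals_def multiset.map_comp comp_def)
qed


section \<open>Majorization\<close>

(* The right-hand vector may be shorter; it is then padded with zeros, and the padded vector
   is rearranged. *)
definition majorized :: "real list \<Rightarrow> real list \<Rightarrow> bool" (infix \<open>\<prec>\<^sub>m\<close> 50) where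
  "xs \<prec>\<^sub>m ys \<longleftrightarrow>
     (let N = length xs; zs = ys @ replicate (N - length ys) 0 in
        length ys \<le> N \<and>
        (\<forall>k \<in> {1..N}. sum_list (take k (decreasing xs)) \<le> sum_list (take k (decreasing zs))) \<and>
        sum_list (decreasing xs) = sum_list (decreasing zs))"


section \<open>Block matrices\<close>

text \<open>
  An \<open>m\<close> by \<open>m\<close> block matrix with blocks of size \<open>n\<close> by \<open>n\<close> is an \<open>m * n\<close> by \<open>m * n\<close> matrix
  whose entry at row \<open>i * n + k\<close> and column \<open>j * n + l\<close> is the \<open>(k, l)\<close> entry of block \<open>(i, j)\<close>.
  All indices start at \<open>0\<close>.
\<close>

definition block :: "nat \<Rightarrow> complex mat \<Rightarrow> nat \<Rightarrow> nat \<Rightarrow> complex mat" where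
  "block n A i j = mat n n (\<lambda>(k, l). A $$ (i * n + k, j * n + l))"

definition mat_of_blocks :: "nat \<Rightarrow> nat \<Rightarrow> (nat \<Rightarrow> nat \<Rightarrow> complex mat) \<Rightarrow> complex mat" where
  "mat_of_blocks m n B =
     mat (m * n) (m * n) (\<lambda>(r, c). B (r div n) (c div n) $$ (r mod n, c mod n))"

lemma block_index_less:
  fixes i k m n :: nat
  assumes "i < m" "k < n"
  shows "i * n + k < m * n"
proof -
  have "i * n + k < Suc i * n" using assms by simp
  also have "\<dots> \<le> m * n" using assms by (intro mult_le_mono1) simp
  finally show ?thesis .
qed

lemma block_mat_of_blocks:
  assumes "i < m" "j < m" "B i j \<in> carrier_mat n n"
  shows "block n (mat_of_blocks m n B) i j = B i j"
  using assms by (intro eq_matI) (auto simp: block_def mat_of_blocks_def block_index_less)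

lemma mat_of_blocks_block:
  assumes "A \<in> carrier_mat (m * n) (m * n)"
  shows "mat_of_blocks m n (block n A) = A"
proof (cases "n = 0")
  case False
  then show ?thesis using assms by (intro eq_matI) (auto simp: block_def mat_of_blocks_def)
qed (use assms in \<open>auto simp: mat_of_blocks_def\<close>)

definition partial_transpose :: "nat \<Rightarrow> nat \<Rightarrow> complex mat \<Rightarrow> complex mat" where
  "partial_transpose m n A = mat_of_blocks m n (\<lambda>i j. block n A j i)"

definition ppt :: "nat \<Rightarrow> nat \<Rightarrow> complex mat \<Rightarrow> bool" where
  "ppt m n A \<longleftrightarrow> psd A \<and> psd (partial_transpose m n A)"

definition partial_trace1 :: "nat \<Rightarrow> nat \<Rightarrow> complex mat \<Rightarrow> complex mat" where
  "partial_trace1 m n A = mat n n (\<lambda>(k, l). \<Sum>i<m. block n A i i $$ (k, l))"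

definition partial_trace2 :: "nat \<Rightarrow> nat \<Rightarrow> complex mat \<Rightarrow> complex mat" where
  "partial_trace2 m n A = mat m m (\<lambda>(i, j). mat_trace (block n A i j))"

end

theory Submission
  imports Defs
begin

text \<open>
  Write \<open>B = tr\<^sub>1 A\<close>, and let \<open>\<lambda>\<^sub>j\<close>, \<open>u\<^sub>j\<close> and \<open>\<beta>\<^sub>l\<close>, \<open>e\<^sub>l\<close> be the eigenvalues and orthonormal
  eigenvectors of \<open>A\<close> and \<open>B\<close>. The theorem has two ingredients.

  The first is the reduction criterion: positivity of \<open>A\<^sup>\<tau>\<close> gives \<open>A \<le> I \<otimes> B\<close>
  (\<open>reduction_inequality\<close>). The difference of the two sides is half the sum of the forms of
  \<open>A\<^sup>\<tau>\<close> at vectors that are antisymmetric in a pair of blocks.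

  The second turns this operator inequality into majorization, following an idea of Hiroshima. Let
  \<open>p\<^sub>j\<^sub>l = u\<^sub>j\<^sup>* (I \<otimes> e\<^sub>l e\<^sub>l\<^sup>*) u\<^sub>j\<close>. Then \<open>\<Sum>\<^sub>l p\<^sub>j\<^sub>l = 1\<close>, and the definition of
  the partial trace says \<open>\<Sum>\<^sub>j \<lambda>\<^sub>j p\<^sub>j\<^sub>l = \<beta>\<^sub>l\<close>. So the numbers \<open>w\<^sub>j\<^sub>l = \<lambda>\<^sub>j p\<^sub>j\<^sub>l / \<beta>\<^sub>l\<close>
  (with \<open>x / 0 = 0\<close>) form a nonnegative matrix that maps the vector \<open>\<beta>\<close> to \<open>\<lambda>\<close> and whose column
  sums are at most \<open>1\<close>.
  Its row sums are \<open>\<lambda>\<^sub>j q\<close> with \<open>q = u\<^sub>j\<^sup>* (I \<otimes> B\<^sup>-\<^sup>1) u\<^sub>j\<close>. The reduction criterion at the vector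
  \<open>(I \<otimes> B\<^sup>-\<^sup>1) u\<^sub>j\<close> gives \<open>\<lambda>\<^sub>j q\<^sup>2 \<le> q\<close>, so the row sums are at most \<open>1\<close> as well, and
  a doubly substochastic image of \<open>\<beta>\<close> with the same total is majorized by \<open>\<beta>\<close>
  (\<open>majorized_if_substochastic\<close>). The two steps meet in \<open>majorized_by_partial_trace\<close>.

  The other cases are instances of the same statement: \<open>A\<^sup>\<tau>\<close> satisfies the same hypotheses as \<open>A\<close>
  and has the same \<open>tr\<^sub>1\<close>, while \<open>tr\<^sub>2 A\<^sup>\<tau>\<close> is the transpose of \<open>tr\<^sub>2 A\<close> and so has the same eigenvalues.
  Finally, \<open>tr\<^sub>2\<close> is \<open>tr\<^sub>1\<close> with the two tensor factors exchanged, where the partial transpose becomes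
  \<open>(A\<^sup>\<tau>)\<^sup>T\<close>.
\<close>

section \<open>The spectral theorem for Hermitian matrices\<close>

lemma mat_adjoint_index [simp]:
  fixes A :: "complex mat"
  assumes "i < dim_col A" "j < dim_row A"
  shows "mat_adjoint A $$ (i, j) = cnj (A $$ (j, i))"
  using assms by (simp add: mat_adjoint_def mat_of_rows_def)

lemma mat_adjoint_dim [simp]:
  fixes A :: "complex mat"
  shows "dim_row (mat_adjoint A) = dim_col A" "dim_col (mat_adjoint A) = dim_row A"
  by (simp_all add: mat_adjoint_def mat_of_rows_def)

lemma mat_adjoint_carrier [simp]:
  fixes A :: "complex mat"
  assumes "A \<in> carrier_mat n k" shows "mat_adjoint A \<in> carrier_mat k n"
  using assms by (intro carrier_matI) auto

lemma mat_adjoint_adjoint [simp]: "mat_adjoint (mat_adjoint A) = (A :: complex mat)"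
  by (intro eq_matI) auto

lemma mat_adjoint_mult:
  fixes A B :: "complex mat"
  assumes "A \<in> carrier_mat n k" "B \<in> carrier_mat k l"
  shows "mat_adjoint (A * B) = mat_adjoint B * mat_adjoint A"
  using assms by (intro eq_matI) (auto simp: scalar_prod_def mult.commute)

text \<open>
  Gram--Schmidt produces an orthogonal basis starting with \<open>v\<close>; its vectors still have to be
  normalised, which is why the first column is only proportional to \<open>v\<close>.
\<close>

lemma ex_unitary_first_column:
  fixes v :: "complex vec"
  assumes v: "v \<in> carrier_vec n" and v0: "v \<noteq> 0\<^sub>v n"
  shows "\<exists>W \<in> carrier_mat n n. \<exists>c. mat_adjoint W * W = 1\<^sub>m n \<and> col W 0 = c \<cdot>\<^sub>v v"
proof -
  have n: "n \<noteq> 0" using v v0 by (metis carrier_vecD eq_vecI not_less0 index_zero_vec(2))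
  define b where "b = basis_completion v"
  define ws where "ws = gram_schmidt n b"
  interpret cof_vec_space n "TYPE(complex)" .
  from basis_completion[OF v v0, folded b_def]
  have dist_b: "distinct b" and indep: "\<not> lin_dep (set b)" and b: "set b \<subseteq> carrier_vec n"
    and hdb: "hd b = v" and len_b: "length b = n" by auto
  from hdb len_b n obtain vs where bv: "b = v # vs" by (cases b, auto)
  from gram_schmidt_result[OF b dist_b indep refl, folded ws_def]
  have ws: "set ws \<subseteq> carrier_vec n" "corthogonal ws" "length ws = n"
    by (auto simp: len_b)
  have hdws: "hd ws = v" using gram_schmidt_hd[OF v, of vs, folded bv] unfolding ws_def .
  have ws0: "ws ! 0 = v" using hdws ws(3) n by (cases ws) auto
  define r where "r j = complex_of_real (sqrt (Re (ws ! j \<bullet>c ws ! j)))" for j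
  have wsc: "ws ! j \<in> carrier_vec n" if "j < n" for j using ws that by auto
  have rr: "r j * r j = ws ! j \<bullet>c ws ! j" "cnj (r j) = r j" "r j \<noteq> 0" if "j < n" for j
  proof -
    have ge: "0 \<le> ws ! j \<bullet>c ws ! j"
      by (rule conjugate_square_ge_0_vec)
    then have "r j * r j = complex_of_real (Re (ws ! j \<bullet>c ws ! j))"
      by (simp add: r_def less_eq_complex_def flip: of_real_mult)
    also have "\<dots> = ws ! j \<bullet>c ws ! j" using ge by (simp add: less_eq_complex_def complex_eq_iff)
    finally show *: "r j * r j = ws ! j \<bullet>c ws ! j" .
    show "cnj (r j) = r j" by (simp add: r_def)
    show "r j \<noteq> 0" using * corthogonalD[OF ws(2), of j j] that ws(3) by auto
  qed
  define W where "W = mat n n (\<lambda>(i, j). ws ! j $ i / r j)"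
  have W: "W \<in> carrier_mat n n" by (simp add: W_def)
  have "mat_adjoint W * W = 1\<^sub>m n"
  proof (rule eq_matI)
    fix i j assume ij: "i < dim_row (1\<^sub>m n :: complex mat)" "j < dim_col (1\<^sub>m n :: complex mat)"
    then have ij: "i < n" "j < n" by auto
    have "(mat_adjoint W * W) $$ (i, j) = (\<Sum>k<n. cnj (ws ! i $ k) / r i * (ws ! j $ k / r j))"
      using ij W rr(2) by (simp add: scalar_prod_def atLeast0LessThan W_def)
    also have "\<dots> = (ws ! j \<bullet>c ws ! i) / (r i * r j)"
      using carrier_vecD[OF wsc[OF ij(1)]] by (simp add: scalar_prod_def atLeast0LessThan sum_divide_distrib mult.commute)
    also have "\<dots> = (if i = j then 1 else 0)"
      using corthogonalD[OF ws(2), of j i] ij ws(3) rr[OF ij(1)] by auto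
    finally show "(mat_adjoint W * W) $$ (i, j) = 1\<^sub>m n $$ (i, j)" using ij by simp
  qed (use W in auto)
  moreover have "col W 0 = (1 / r 0) \<cdot>\<^sub>v v"
    using n ws0 v by (intro eq_vecI) (auto simp: W_def)
  ultimately show ?thesis using W by blast
qed

text \<open>
  Deflation: in an orthonormal basis whose first vector is an eigenvector for \<open>e\<close>, the first
  column of \<open>H\<close> is zero below \<open>e\<close>. Since conjugation by a unitary matrix keeps \<open>H\<close> self-adjoint,
  the first row vanishes too, and the remaining block is self-adjoint again with the factor for
  \<open>e\<close> removed from the characteristic polynomial. Keeping the order of the given list \<open>es\<close>
  lets the diagonal be any chosen enumeration of the eigenvalues.
\<close>

lemma unitary_diagonalization:
  fixes H :: "complex mat"
  assumes "H \<in> carrier_mat n n" and "mat_adjoint H = H"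
    and "char_poly H = (\<Prod>e\<leftarrow>es. [:- e, 1:])"
  shows "\<exists>U \<in> carrier_mat n n. mat_adjoint U * U = 1\<^sub>m n \<and> H * U = U * mat_diag n (\<lambda>i. es ! i)"
  using assms
proof (induction es arbitrary: n H)
  case Nil
  then have "n = 0" using degree_monic_char_poly[of H n] by auto
  then show ?case using Nil by (intro bexI[of _ "1\<^sub>m 0"] conjI eq_matI) (auto simp: mat_diag_def)
next
  case (Cons e es)
  note H = Cons.prems(1) and herm = Cons.prems(2)
  have cp: "char_poly H = [:-e, 1:] * (\<Prod>e\<leftarrow>es. [:- e, 1:])" using Cons.prems(3) by simp
  have "eigenvalue H e" unfolding eigenvalue_root_char_poly[OF H] cp by simp
  then obtain v where v: "v \<in> carrier_vec n" "v \<noteq> 0\<^sub>v n" "H *\<^sub>v v = e \<cdot>\<^sub>v v"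
    using H by (auto simp: eigenvalue_def eigenvector_def)
  have "n \<noteq> 0" using v(1,2) by (metis carrier_vecD eq_vecI not_less0 index_zero_vec(2))
  then obtain k where n: "n = Suc k" by (cases n) auto
  obtain W c where W: "W \<in> carrier_mat n n" and WW: "mat_adjoint W * W = 1\<^sub>m n"
    and col0: "col W 0 = c \<cdot>\<^sub>v v" using ex_unitary_first_column[OF v(1,2)] by blast
  have W': "mat_adjoint W \<in> carrier_mat n n" using W by simp
  have WW': "W * mat_adjoint W = 1\<^sub>m n" by (rule mat_mult_left_right_inverse[OF W' W WW])
  define A where "A = mat_adjoint W * (H * W)"
  have A: "A \<in> carrier_mat n n" unfolding A_def by (intro mult_carrier_mat[OF W'] mult_carrier_mat[OF H W])
  have HW: "H * W = W * A"
  proof -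
    have "W * A = (W * mat_adjoint W) * (H * W)"
      unfolding A_def by (rule assoc_mult_mat[symmetric]) (use W W' H in auto)
    then show ?thesis using WW' W H by simp
  qed
  have Aherm: "mat_adjoint A = A"
  proof -
    have "mat_adjoint A = mat_adjoint (H * W) * W"
      unfolding A_def using mat_adjoint_mult[OF W', of "H * W" n] W H by simp
    also have "\<dots> = mat_adjoint W * H * W"
      using mat_adjoint_mult[OF H W] herm by simp
    also have "\<dots> = A" unfolding A_def by (rule assoc_mult_mat) (use W W' H in auto)
    finally show ?thesis .
  qed
  have Acol: "A $$ (i, 0) = (if i = 0 then e else 0)" if i: "i < n" for i
  proof -
    have "col (H * W) 0 = e \<cdot>\<^sub>v col W 0"
    proof -
      have "col (H * W) 0 = H *\<^sub>v col W 0" using H W n by auto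
      also have "\<dots> = e \<cdot>\<^sub>v col W 0"
        unfolding col0 using mult_mat_vec[OF H v(1)] v by (simp add: smult_smult_assoc mult.commute)
      finally show ?thesis .
    qed
    then have "A $$ (i, 0) = row (mat_adjoint W) i \<bullet> (e \<cdot>\<^sub>v col W 0)"
      using W H i n by (simp add: A_def)
    also have "\<dots> = e * (row (mat_adjoint W) i \<bullet> col W 0)"
      using W W' i n by (intro scalar_prod_smult_distrib[of _ n]) (auto intro!: carrier_vecI)
    also have "row (mat_adjoint W) i \<bullet> col W 0 = (mat_adjoint W * W) $$ (i, 0)"
      using W i n by simp
    also have "\<dots> = (if i = 0 then 1 else 0)" using WW i n by simp
    finally show ?thesis by simp
  qed
  have Arow: "A $$ (0, i) = (if i = 0 then cnj e else 0)" if i: "i < n" for i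
    using arg_cong[OF Aherm, of "\<lambda>M. M $$ (0, i)"] A i n Acol[OF i] by auto
  define A1 where "A1 = mat 1 1 (\<lambda>_. e)"
  define A3 where "A3 = mat k k (\<lambda>(i, j). A $$ (Suc i, Suc j))"
  have A1: "A1 \<in> carrier_mat 1 1" and A3: "A3 \<in> carrier_mat k k" by (auto simp: A1_def A3_def)
  have "cnj e = e" using Acol[of 0] Arow[of 0] n by simp
  then have Ablock: "A = four_block_mat A1 (0\<^sub>m 1 k) (0\<^sub>m k 1) A3"
    using A Acol Arow n by (intro eq_matI) (auto simp: A1_def A3_def)
  have A3herm: "mat_adjoint A3 = A3"
  proof (rule eq_matI)
    fix i j assume "i < dim_row A3" "j < dim_col A3"
    then show "mat_adjoint A3 $$ (i, j) = A3 $$ (i, j)"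
      using A n arg_cong[OF Aherm, of "\<lambda>M. M $$ (Suc i, Suc j)"] by (auto simp: A3_def)
  qed (auto simp: A3_def)
  have "similar_mat H A"
    unfolding similar_mat_def similar_mat_wit_def Let_def
  proof (intro exI conjI)
    show "H = W * A * mat_adjoint W"
      unfolding HW[symmetric] using assoc_mult_mat[OF H W W'] WW' H by simp
  qed (use H A W W' WW WW' in auto)
  then have "char_poly A = char_poly H" by (metis char_poly_similar)
  moreover have "char_poly A = char_poly A1 * char_poly A3"
    unfolding Ablock by (rule char_poly_four_block_zeros_col[OF A1 _ A3]) simp
  moreover have "char_poly A1 = [:- e, 1:]"
    by (simp add: A1_def char_poly_defs det_def sign_def)
  ultimately have cp3: "char_poly A3 = (\<Prod>e\<leftarrow>es. [:- e, 1:])"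
    using cp by (metis mult_cancel_left pCons_eq_0_iff zero_neq_one)
  obtain V where V: "V \<in> carrier_mat k k" and VV: "mat_adjoint V * V = 1\<^sub>m k"
    and AV: "A3 * V = V * mat_diag k (\<lambda>i. es ! i)" using Cons.IH[OF A3 A3herm cp3] by blast
  define F where "F = four_block_mat (1\<^sub>m 1) (0\<^sub>m 1 k) (0\<^sub>m k 1) V"
  let ?D = "mat_diag n (\<lambda>i. (e # es) ! i)"
  have F: "F \<in> carrier_mat n n" using V n by (auto simp: F_def)
  have F': "mat_adjoint F = four_block_mat (1\<^sub>m 1) (0\<^sub>m 1 k) (0\<^sub>m k 1) (mat_adjoint V)"
    using V by (intro eq_matI) (auto simp: F_def)
  have FF: "mat_adjoint F * F = 1\<^sub>m n"
    unfolding F' unfolding F_def using V VV n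
    by (subst mult_four_block_mat[where ?nr1.0 = 1 and ?n1.0 = 1 and ?n2.0 = k and ?nr2.0 = k and ?nc1.0 = 1 and ?nc2.0 = k]) auto
  have D: "?D = four_block_mat A1 (0\<^sub>m 1 k) (0\<^sub>m k 1) (mat_diag k (\<lambda>i. es ! i))"
    using n by (intro eq_matI) (auto simp: A1_def mat_diag_def nth_Cons')
  have AF: "A * F = F * ?D"
  proof -
    have "A * F = four_block_mat A1 (0\<^sub>m 1 k) (0\<^sub>m k 1) (A3 * V)"
      unfolding Ablock F_def using V A1 A3
      by (subst mult_four_block_mat[where ?nr1.0 = 1 and ?n1.0 = 1 and ?n2.0 = k and ?nr2.0 = k and ?nc1.0 = 1 and ?nc2.0 = k]) auto
    moreover have "F * ?D = four_block_mat A1 (0\<^sub>m 1 k) (0\<^sub>m k 1) (V * mat_diag k (\<lambda>i. es ! i))"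
      unfolding D F_def using V A1
      by (subst mult_four_block_mat[where ?nr1.0 = 1 and ?n1.0 = 1 and ?n2.0 = k and ?nr2.0 = k and ?nc1.0 = 1 and ?nc2.0 = k]) (auto simp: left_mult_zero_mat[OF mat_diag_dim])
    ultimately show ?thesis using AV by simp
  qed
  have Dc: "?D \<in> carrier_mat n n" by simp
  have "mat_adjoint (W * F) * (W * F) = mat_adjoint F * (mat_adjoint W * (W * F))"
    unfolding mat_adjoint_mult[OF W F] by (rule assoc_mult_mat) (use W F in auto)
  also have "mat_adjoint W * (W * F) = (mat_adjoint W * W) * F"
    by (rule assoc_mult_mat[symmetric]) (use W F in auto)
  also have "mat_adjoint F * \<dots> = 1\<^sub>m n" using WW FF F by simp
  finally have "mat_adjoint (W * F) * (W * F) = 1\<^sub>m n" .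
  moreover have "H * (W * F) = W * F * ?D"
  proof -
    have "H * (W * F) = W * A * F" unfolding HW[symmetric] by (rule assoc_mult_mat[symmetric, OF H W F])
    also have "\<dots> = W * (F * ?D)" unfolding AF[symmetric] by (rule assoc_mult_mat[OF W A F])
    also have "\<dots> = W * F * ?D" by (rule assoc_mult_mat[symmetric, OF W F Dc])
    finally show ?thesis .
  qed
  ultimately show ?case using W F by (intro bexI[of _ "W * F"]) auto
qed

text \<open>
  Here \<open>u j\<close> is the eigenvector for the \<open>j\<close>-th largest eigenvalue. The three clauses are
  orthonormality, completeness and the spectral decomposition, written in coordinates so that
  the double sums over a product index set below need no matrix algebra.
\<close>

theorem spectral_theorem:
  assumes "hermitian H" and H: "H \<in> carrier_mat n n"
  obtains u :: "nat \<Rightarrow> nat \<Rightarrow> complex" where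
    "\<And>i j. i < n \<Longrightarrow> j < n \<Longrightarrow> (\<Sum>x<n. cnj (u i x) * u j x) = (if i = j then 1 else 0)"
    "\<And>x y. x < n \<Longrightarrow> y < n \<Longrightarrow> (\<Sum>j<n. u j x * cnj (u j y)) = (if x = y then 1 else 0)"
    "\<And>x y. x < n \<Longrightarrow> y < n \<Longrightarrow>
       H $$ (x, y) = (\<Sum>j<n. complex_of_real (eigvals H ! j) * (u j x * cnj (u j y)))"
proof -
  let ?es = "map complex_of_real (eigvals H)"
  have "char_poly H = (\<Prod>x\<in>#proots (char_poly H). [:- x, 1:])"
    using complex_poly_decompose_multiset[of "char_poly H"] degree_monic_char_poly[OF H] by simp
  also have "\<dots> = (\<Prod>e\<leftarrow>?es. [:- e, 1:])"
    unfolding hermitian_eigvals[OF assms(1), symmetric]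
    by (simp add: multiset.map_comp comp_def flip: prod_mset_prod_list)
  finally have cp: "char_poly H = (\<Prod>e\<leftarrow>?es. [:- e, 1:])" .
  obtain U where U: "U \<in> carrier_mat n n" and UU: "mat_adjoint U * U = 1\<^sub>m n"
    and HU: "H * U = U * mat_diag n (\<lambda>i. ?es ! i)"
    using unitary_diagonalization[OF H _ cp] assms(1) by (auto simp: hermitian_def)
  have U': "mat_adjoint U \<in> carrier_mat n n" using U by simp
  have UU': "U * mat_adjoint U = 1\<^sub>m n" by (rule mat_mult_left_right_inverse[OF U' U UU])
  show thesis
  proof (rule that[of "\<lambda>j x. U $$ (x, j)"])
    fix i j assume "i < n" "j < n"
    then show "(\<Sum>x<n. cnj (U $$ (x, i)) * U $$ (x, j)) = (if i = j then 1 else 0)"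
      using arg_cong[OF UU, of "\<lambda>M. M $$ (i, j)"] U
      by (simp add: scalar_prod_def atLeast0LessThan)
  next
    fix x y assume "x < n" "y < n"
    then show "(\<Sum>j<n. U $$ (x, j) * cnj (U $$ (y, j))) = (if x = y then 1 else 0)"
      using arg_cong[OF UU', of "\<lambda>M. M $$ (x, y)"] U
      by (simp add: scalar_prod_def atLeast0LessThan)
  next
    fix x y assume xy: "x < n" "y < n"
    have "H = H * U * mat_adjoint U" using assoc_mult_mat[OF H U U'] UU' H by simp
    then have "H $$ (x, y) = (U * mat_diag n (\<lambda>i. ?es ! i) * mat_adjoint U) $$ (x, y)"
      unfolding HU by simp
    also have "\<dots> = (\<Sum>j<n. complex_of_real (eigvals H ! j) * (U $$ (x, j) * cnj (U $$ (y, j))))"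
      using xy U mat_diag_mult_right[OF U] length_eigvals[OF H]
      by (simp add: scalar_prod_def atLeast0LessThan mult_ac)
    finally show "H $$ (x, y) = \<dots>" .
  qed
qed

section \<open>Majorization by doubly substochastic weights\<close>

lemma decreasing_id: "sorted (rev xs) \<Longrightarrow> decreasing xs = xs"
  by (metis decreasing_def mset_rev properties_for_sort rev_rev_ident)

lemma sorted_rev_eigvals: "sorted (rev (eigvals H))"
  by (simp add: eigvals_def)

text \<open>
  Moving weight from an index \<open>\<ge> k\<close> to an index \<open>< k\<close> does not decrease the weighted sum, because
  \<open>y\<close> is decreasing. Quantitatively, the comparison with \<open>y k\<close> on both sides of the cut leaves
  the total excess \<open>((\<Sum>i<n. c i) - k) * y k \<le> 0\<close>.
\<close>

lemma weighted_sum_le_top_sum: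
  fixes y c :: "nat \<Rightarrow> real"
  assumes mono: "\<And>i j. i \<le> j \<Longrightarrow> j < n \<Longrightarrow> y j \<le> y i" and y0: "\<And>i. i < n \<Longrightarrow> 0 \<le> y i"
    and c0: "\<And>i. i < n \<Longrightarrow> 0 \<le> c i" and c1: "\<And>i. i < n \<Longrightarrow> c i \<le> 1"
    and ck: "(\<Sum>i<n. c i) \<le> real k"
  shows "(\<Sum>i<n. c i * y i) \<le> (\<Sum>i<min k n. y i)"
proof (cases "k < n")
  case False
  have "(\<Sum>i<n. c i * y i) \<le> (\<Sum>i<n. y i)"
    using c1 y0 by (intro sum_mono) (simp add: mult_left_le_one_le c0)
  then show ?thesis using False by (simp add: min_def)
next
  case True
  have split: "(\<Sum>i<n. f i) = (\<Sum>i<k. f i) + (\<Sum>i=k..<n. f i)" for f :: "nat \<Rightarrow> real"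
    using sum.atLeastLessThan_concat[of 0 k n f] True by (simp add: atLeast0LessThan)
  have "(\<Sum>i<k. c i * y i - y i) \<le> (\<Sum>i<k. (c i - 1) * y k)"
  proof (rule sum_mono)
    fix i assume "i \<in> {..<k}"
    then have "(1 - c i) * y k \<le> (1 - c i) * y i"
      using True c1 mono[of i k] by (intro mult_left_mono) auto
    then show "c i * y i - y i \<le> (c i - 1) * y k" by (simp add: algebra_simps)
  qed
  moreover have "(\<Sum>i=k..<n. c i * y i) \<le> (\<Sum>i=k..<n. c i * y k)"
    using c0 mono[of k] by (intro sum_mono mult_left_mono) auto
  ultimately have "(\<Sum>i<n. c i * y i) - (\<Sum>i<k. y i) \<le> ((\<Sum>i<n. c i) - real k) * y k"
    unfolding split by (simp add: sum_subtractf sum_distrib_left sum_distrib_right algebra_simps)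
  also have "\<dots> \<le> 0" using ck y0[OF True] by (simp add: mult_nonpos_nonneg)
  finally show ?thesis using True by (simp add: min_def)
qed

text \<open>
  A nonnegative matrix \<open>w\<close> with row and column sums at most \<open>1\<close> maps \<open>ys\<close> to a weakly majorized
  vector: a sum of \<open>k\<close> entries of the image is a weighted sum of \<open>ys\<close> whose weights are at most \<open>1\<close>
  by the column condition and have total at most \<open>k\<close> by the row condition.
  The equality of totals then turns weak majorization into majorization.
\<close>

lemma majorized_if_substochastic:
  fixes w :: "nat \<Rightarrow> nat \<Rightarrow> real"
  assumes xs: "sorted (rev xs)" and ys: "sorted (rev ys)" and len: "length ys \<le> length xs"
    and y0: "\<And>l. l < length ys \<Longrightarrow> 0 \<le> ys ! l"
    and w0: "\<And>j l. j < length xs \<Longrightarrow> l < length ys \<Longrightarrow> 0 \<le> w j l"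
    and row: "\<And>j. j < length xs \<Longrightarrow> (\<Sum>l<length ys. w j l) \<le> 1"
    and col: "\<And>l. l < length ys \<Longrightarrow> (\<Sum>j<length xs. w j l) \<le> 1"
    and image: "\<And>j. j < length xs \<Longrightarrow> xs ! j = (\<Sum>l<length ys. w j l * ys ! l)"
    and total: "(\<Sum>j<length xs. xs ! j) = (\<Sum>l<length ys. ys ! l)"
  shows "xs \<prec>\<^sub>m ys"
proof -
  define zs where "zs = ys @ replicate (length xs - length ys) 0"
  have "\<forall>y\<in>set ys. 0 \<le> y" using y0 by (auto simp: in_set_conv_nth)
  then have "sorted (rev zs)" using ys by (auto simp: zs_def sorted_append)
  then have dec: "decreasing zs = zs" "decreasing xs = xs" using xs decreasing_id by auto
  have lenz: "length zs = length xs" using len by (simp add: zs_def)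
  have takez: "sum_list (take k zs) = (\<Sum>l<min k (length ys). ys ! l)" if "k \<le> length xs" for k
  proof -
    have "sum_list (take k zs) = (\<Sum>l<k. zs ! l)"
      using that lenz by (simp add: sum_list_sum_nth atLeast0LessThan)
    also have "\<dots> = (\<Sum>l<min k (length ys). zs ! l)"
      using that by (intro sum.mono_neutral_right) (auto simp: zs_def nth_append)
    also have "\<dots> = (\<Sum>l<min k (length ys). ys ! l)"
      by (intro sum.cong) (auto simp: zs_def nth_append)
    finally show ?thesis .
  qed
  have takex: "sum_list (take k xs) = (\<Sum>j<k. xs ! j)" if "k \<le> length xs" for k
    using that by (simp add: sum_list_sum_nth atLeast0LessThan)
  have "sum_list (take k xs) \<le> sum_list (take k zs)" if k: "k \<le> length xs" for k
  proof -
    have "(\<Sum>j<k. xs ! j) = (\<Sum>l<length ys. (\<Sum>j<k. w j l) * ys ! l)"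
      using k by (simp add: image sum_distrib_right) (rule sum.swap)
    also have "\<dots> \<le> (\<Sum>l<min k (length ys). ys ! l)"
    proof (rule weighted_sum_le_top_sum)
      fix l assume l: "l < length ys"
      show "0 \<le> (\<Sum>j<k. w j l)" using k l w0 by (intro sum_nonneg) auto
      have "(\<Sum>j<k. w j l) \<le> (\<Sum>j<length xs. w j l)"
        using k l w0 by (intro sum_mono2) auto
      then show "(\<Sum>j<k. w j l) \<le> 1" using col[OF l] by simp
    next
      have "(\<Sum>l<length ys. \<Sum>j<k. w j l) = (\<Sum>j<k. \<Sum>l<length ys. w j l)" by (rule sum.swap)
      also have "\<dots> \<le> (\<Sum>j<k. 1)" using k row by (intro sum_mono) auto
      finally show "(\<Sum>l<length ys. \<Sum>j<k. w j l) \<le> real k" by simp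
    qed (use y0 sorted_rev_nth_mono[OF ys] in auto)
    finally show ?thesis using takex takez k by simp
  qed
  moreover have "sum_list xs = sum_list zs"
    using takex[of "length xs"] takez[of "length xs"] total len lenz by (simp add: min_def)
  ultimately show ?thesis
    using len by (simp add: majorized_def Let_def dec flip: zs_def)
qed

section \<open>Quadratic forms of Hermitian matrices\<close>

lemma adjoint_form:
  fixes M :: "complex mat"
  assumes "M \<in> carrier_mat n n" "v \<in> carrier_vec n"
  shows "(M *\<^sub>v v) \<bullet>c v = (\<Sum>x<n. \<Sum>y<n. cnj (v $ x) * M $$ (x, y) * v $ y)"
  using assms by (simp add: scalar_prod_def sum_distrib_left sum_distrib_right atLeast0LessThan mult_ac)

lemma psd_form_nonneg:
  assumes "psd M" "M \<in> carrier_mat n n"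
  shows "0 \<le> (\<Sum>x<n. \<Sum>y<n. cnj (z x) * M $$ (x, y) * z y)"
proof -
  have "0 \<le> (M *\<^sub>v vec n z) \<bullet>c vec n z" using assms by (auto simp: psd_def)
  then show ?thesis unfolding adjoint_form[OF assms(2) vec_carrier] by simp
qed

lemma hermitian_index:
  assumes "hermitian M" "M \<in> carrier_mat n n" "x < n" "y < n"
  shows "cnj (M $$ (x, y)) = M $$ (y, x)"
proof -
  have "M $$ (y, x) = mat_adjoint M $$ (y, x)" using assms(1) by (simp add: hermitian_def)
  then show ?thesis using assms(2-) by (simp add: mat_adjoint_def mat_of_rows_def)
qed

lemma hermitianI:
  assumes "M \<in> carrier_mat n n" "\<And>x y. x < n \<Longrightarrow> y < n \<Longrightarrow> cnj (M $$ (x, y)) = M $$ (y, x)"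
  shows "hermitian M"
  unfolding hermitian_def using assms
  by (auto intro!: eq_matI simp: mat_adjoint_def mat_of_rows_def)

text \<open>The form of the transpose at \<open>v\<close> is the form of \<open>M\<close> at the conjugate of \<open>v\<close>.\<close>

lemma psd_transpose:
  assumes "psd M" shows "psd (transpose_mat M)"
proof -
  define n where "n = dim_row M"
  have M: "M \<in> carrier_mat n n" using assms by (auto simp: psd_def hermitian_def n_def)
  then have T: "transpose_mat M \<in> carrier_mat n n" by simp
  have "0 \<le> (transpose_mat M *\<^sub>v v) \<bullet>c v" if v: "v \<in> carrier_vec n" for v
  proof -
    have "(transpose_mat M *\<^sub>v v) \<bullet>c v = (\<Sum>x<n. \<Sum>y<n. cnj (v $ x) * M $$ (y, x) * v $ y)"
      unfolding adjoint_form[OF T v] using M by simp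
    also have "\<dots> = (\<Sum>y<n. \<Sum>x<n. cnj (v $ x) * M $$ (y, x) * v $ y)" by (rule sum.swap)
    also have "\<dots> = (\<Sum>y<n. \<Sum>x<n. cnj (cnj (v $ y)) * M $$ (y, x) * cnj (v $ x))"
      by (simp add: mult_ac)
    finally show ?thesis using psd_form_nonneg[OF assms M, of "\<lambda>x. cnj (v $ x)"] by simp
  qed
  moreover have "hermitian (transpose_mat M)"
    using assms M by (intro hermitianI[OF T]) (auto simp: psd_def hermitian_index)
  ultimately show ?thesis using M by (auto simp: psd_def)
qed

lemma form_spectral:
  fixes u :: "nat \<Rightarrow> 'a \<Rightarrow> complex" and ev :: "nat \<Rightarrow> real"
  assumes "\<And>x y. x \<in> X \<Longrightarrow> y \<in> X \<Longrightarrow> M x y = (\<Sum>j<n. complex_of_real (ev j) * (u j x * cnj (u j y)))"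
  shows "(\<Sum>x\<in>X. \<Sum>y\<in>X. cnj (z x) * M x y * z y) =
    complex_of_real (\<Sum>j<n. ev j * (cmod (\<Sum>x\<in>X. cnj (u j x) * z x))\<^sup>2)"
proof -
  have "(\<Sum>x\<in>X. \<Sum>y\<in>X. cnj (z x) * M x y * z y) =
      (\<Sum>x\<in>X. \<Sum>y\<in>X. \<Sum>j<n. complex_of_real (ev j) * ((cnj (u j y) * z y) * cnj (cnj (u j x) * z x)))"
    by (intro sum.cong refl) (simp add: assms sum_distrib_left sum_distrib_right mult_ac)
  also have "\<dots> = (\<Sum>x\<in>X. \<Sum>j<n. \<Sum>y\<in>X. complex_of_real (ev j) * ((cnj (u j y) * z y) * cnj (cnj (u j x) * z x)))"
    by (intro sum.cong refl sum.swap)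
  also have "\<dots> = (\<Sum>j<n. \<Sum>x\<in>X. \<Sum>y\<in>X. complex_of_real (ev j) * ((cnj (u j y) * z y) * cnj (cnj (u j x) * z x)))"
    by (rule sum.swap)
  also have "\<dots> = (\<Sum>j<n. complex_of_real (ev j) *
      ((\<Sum>y\<in>X. cnj (u j y) * z y) * cnj (\<Sum>x\<in>X. cnj (u j x) * z x)))"
    by (intro sum.cong refl) (simp add: sum_distrib_left sum_distrib_right mult_ac)
  also have "\<dots> = complex_of_real (\<Sum>j<n. ev j * (cmod (\<Sum>x\<in>X. cnj (u j x) * z x))\<^sup>2)"
    by (simp only: complex_norm_square[symmetric] of_real_sum of_real_mult)
  finally show ?thesis .
qed

lemma parseval:
  fixes u :: "nat \<Rightarrow> 'a \<Rightarrow> complex"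
  assumes "finite X"
    and "\<And>x y. x \<in> X \<Longrightarrow> y \<in> X \<Longrightarrow> (\<Sum>j<n. u j x * cnj (u j y)) = (if x = y then 1 else 0)"
  shows "(\<Sum>j<n. (cmod (\<Sum>x\<in>X. cnj (u j x) * z x))\<^sup>2) = (\<Sum>x\<in>X. (cmod (z x))\<^sup>2)"
proof -
  have "complex_of_real (\<Sum>j<n. 1 * (cmod (\<Sum>x\<in>X. cnj (u j x) * z x))\<^sup>2) =
      (\<Sum>x\<in>X. \<Sum>y\<in>X. cnj (z x) * (if x = y then 1 else 0) * z y)"
    by (rule form_spectral[symmetric]) (simp add: assms(2))
  also have "\<dots> = (\<Sum>x\<in>X. cnj (z x) * z x)"
    using assms(1) by (simp add: if_distrib[of "\<lambda>c. c * _"] if_distrib[of "\<lambda>c. _ * c"] cong: if_cong)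
  also have "\<dots> = complex_of_real (\<Sum>x\<in>X. (cmod (z x))\<^sup>2)"
    by (simp only: complex_norm_square mult.commute of_real_sum)
  finally show ?thesis by (simp only: of_real_eq_iff mult_1)
qed

section \<open>The reduction criterion\<close>

lemma sum_sum_of_bool:
  fixes f :: "nat \<Rightarrow> nat \<Rightarrow> complex"
  assumes "p < a" "q < a"
  shows "(\<Sum>s<a. \<Sum>t<a. of_bool (s = p) * (of_bool (t = q) * f s t)) = f p q"
proof -
  have "(\<Sum>t<a. of_bool (s = p) * (of_bool (t = q) * f s t)) = (if s = p then f p q else 0)" for s
    using assms(2) by (simp add: if_distrib[of "\<lambda>c. c * _"] of_bool_def cong: if_cong)
  then show ?thesis using assms(1) by simp
qed

text \<open>
  If \<open>c\<close> is the coefficient array of a positive semidefinite block matrix \<open>C\<close>, then the array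
  \<open>c j k i l\<close> is that of its partial transpose \<open>C\<^sup>\<tau>\<close>, and the lemma says that
  \<open>C\<^sup>\<tau> \<le> I \<otimes> tr\<^sub>1 C\<close>. For a vector \<open>z\<close> with blocks \<open>z\<^sub>i\<close> and two block positions
  \<open>i, j\<close>, let \<open>y\<close> carry \<open>z\<^sub>i\<close> in position \<open>j\<close> and \<open>- z\<^sub>j\<close> in position \<open>i\<close> (so \<open>y = 0\<close> if \<open>i = j\<close>).
  The form of \<open>C\<close> at \<open>y\<close> has the diagonal terms \<open>z\<^sub>i\<^sup>* C\<^sub>j\<^sub>j z\<^sub>i\<close> and \<open>z\<^sub>j\<^sup>* C\<^sub>i\<^sub>i z\<^sub>j\<close>
  and the cross terms \<open>- z\<^sub>i\<^sup>* C\<^sub>j\<^sub>i z\<^sub>j\<close> and \<open>- z\<^sub>j\<^sup>* C\<^sub>i\<^sub>j z\<^sub>i\<close>. Summed over all pairs this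
  is twice the difference of the two sides.
\<close>

lemma reduction_inequality:
  fixes c :: "nat \<Rightarrow> nat \<Rightarrow> nat \<Rightarrow> nat \<Rightarrow> complex"
  assumes pos: "\<And>y. 0 \<le> (\<Sum>i<a. \<Sum>k<b. \<Sum>j<a. \<Sum>l<b. cnj (y i k) * c i k j l * y j l)"
  shows "(\<Sum>i<a. \<Sum>k<b. \<Sum>j<a. \<Sum>l<b. cnj (z i k) * c j k i l * z j l) \<le>
    (\<Sum>i<a. \<Sum>k<b. \<Sum>l<b. cnj (z i k) * (\<Sum>s<a. c s k s l) * z i l)"
    (is "?L \<le> ?R")
proof -
  \<comment> \<open>\<open>G s t i j\<close> stands for \<open>z\<^sub>i\<^sup>* C\<^sub>s\<^sub>t z\<^sub>j\<close>.\<close>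
  define G where "G s t i j = (\<Sum>k<b. \<Sum>l<b. cnj (z i k) * c s k t l * z j l)" for s t i j
  have G_pos: "0 \<le> G j j i i - G j i i j - G i j j i + G i i j j" if ij: "i < a" "j < a" for i j
  proof -
    define y where "y s k = of_bool (s = j) * z i k - of_bool (s = i) * z j k" for s k
    have "(\<Sum>s<a. \<Sum>k<b. \<Sum>t<a. \<Sum>l<b. cnj (y s k) * c s k t l * y t l) =
        (\<Sum>s<a. \<Sum>t<a. \<Sum>k<b. \<Sum>l<b. cnj (y s k) * c s k t l * y t l)"
      by (intro sum.cong refl sum.swap)
    also have "\<dots> = (\<Sum>s<a. \<Sum>t<a.
        of_bool (s = j) * (of_bool (t = j) * G s t i i) - of_bool (s = j) * (of_bool (t = i) * G s t i j)
        - of_bool (s = i) * (of_bool (t = j) * G s t j i) + of_bool (s = i) * (of_bool (t = i) * G s t j j))"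
      unfolding G_def sum_distrib_left sum_subtractf[symmetric] sum.distrib[symmetric]
      by (intro sum.cong refl) (simp add: y_def algebra_simps)
    also have "\<dots> = G j j i i - G j i i j - G i j j i + G i i j j"
      using ij by (simp only: sum.distrib sum_subtractf sum_sum_of_bool)
    finally show ?thesis using pos[of y] by simp
  qed
  have "0 \<le> (\<Sum>i<a. \<Sum>j<a. G j j i i - G j i i j - G i j j i + G i i j j)"
    using G_pos by (intro sum_nonneg) auto
  also have "\<dots> = 2 * ((\<Sum>i<a. \<Sum>j<a. G j j i i) - (\<Sum>i<a. \<Sum>j<a. G j i i j))"
    using sum.swap[of "\<lambda>i j. G i j j i" "{..<a}" "{..<a}"]
      sum.swap[of "\<lambda>i j. G i i j j" "{..<a}" "{..<a}"]
    by (simp add: sum.distrib sum_subtractf)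
  finally have "(\<Sum>i<a. \<Sum>j<a. G j i i j) \<le> (\<Sum>i<a. \<Sum>j<a. G j j i i)"
    by (simp add: less_eq_complex_def)
  moreover have "(\<Sum>i<a. \<Sum>j<a. G j i i j) = ?L"
    unfolding G_def by (intro sum.cong refl sum.swap)
  moreover have "(\<Sum>i<a. \<Sum>j<a. G j j i i) = ?R"
  proof -
    have "(\<Sum>j<a. G j j i i) = (\<Sum>k<b. \<Sum>l<b. cnj (z i k) * (\<Sum>s<a. c s k s l) * z i l)" for i
    proof -
      have "(\<Sum>j<a. G j j i i) = (\<Sum>k<b. \<Sum>j<a. \<Sum>l<b. cnj (z i k) * c j k j l * z i l)"
        unfolding G_def by (rule sum.swap)
      also have "\<dots> = (\<Sum>k<b. \<Sum>l<b. \<Sum>j<a. cnj (z i k) * c j k j l * z i l)"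
        by (intro sum.cong refl sum.swap)
      finally show ?thesis by (simp add: sum_distrib_left sum_distrib_right)
    qed
    then show ?thesis by simp
  qed
  ultimately show ?thesis by simp
qed

section \<open>Majorization by partial traces\<close>

text \<open>
  The indexing \<open>\<phi>\<close> makes the set of rows into a product of \<open>a\<close> block positions and \<open>b\<close> positions
  inside a block. Keeping it arbitrary treats both partial traces at once: \<open>\<phi> i k = i * n + k\<close> gives
  \<open>tr\<^sub>1\<close>, and exchanging the roles of \<open>i\<close> and \<open>k\<close> gives \<open>tr\<^sub>2\<close> without conjugating by a permutation
  matrix. The matrix \<open>C\<close> is the partial transpose of \<open>A\<close> with respect to \<open>\<phi>\<close>.
\<close>

lemma majorized_by_partial_trace:
  fixes \<phi> :: "nat \<Rightarrow> nat \<Rightarrow> nat"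
  assumes a: "0 < a"
    and bij: "bij_betw (\<lambda>(i, k). \<phi> i k) ({..<a} \<times> {..<b}) {..<N}"
    and A: "psd A" "A \<in> carrier_mat N N"
    and C: "psd C" "C \<in> carrier_mat N N"
    and CA: "\<And>i j k l. i < a \<Longrightarrow> j < a \<Longrightarrow> k < b \<Longrightarrow> l < b \<Longrightarrow>
      A $$ (\<phi> i k, \<phi> j l) = C $$ (\<phi> j k, \<phi> i l)"
    and B: "B \<in> carrier_mat b b"
      "\<And>k l. k < b \<Longrightarrow> l < b \<Longrightarrow> B $$ (k, l) = (\<Sum>i<a. A $$ (\<phi> i k, \<phi> i l))"
  shows "eigvals A \<prec>\<^sub>m eigvals B"
proof -
  have \<phi>: "\<phi> i k < N" if "i < a" "k < b" for i k
    using bij_betwE[OF bij] that by auto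
  define coords where "coords = the_inv_into ({..<a} \<times> {..<b}) (\<lambda>(i, k). \<phi> i k)"
  have coords: "coords (\<phi> i k) = (i, k)" if "i < a" "k < b" for i k
    using the_inv_into_f_f[of "\<lambda>(i, k). \<phi> i k" "{..<a} \<times> {..<b}" "(i, k)"] bij that
    by (simp add: bij_betw_def coords_def)
  have sum_\<phi>: "(\<Sum>x<N. f x) = (\<Sum>i<a. \<Sum>k<b. f (\<phi> i k))" for f :: "nat \<Rightarrow> complex"
    using sum.reindex_bij_betw[OF bij, of f] by (simp add: sum.cartesian_product split_beta)
  have N: "N = a * b" using bij_betw_same_card[OF bij] by (simp add: card_cartesian_product)
  have bN: "b \<le> N" using a N by simp
  have hA: "hermitian A" using A(1) by (simp add: psd_def)
  have hB: "hermitian B"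
    by (rule hermitianI[OF B(1)]) (simp add: B(2) \<phi> hermitian_index[OF hA A(2)])
  have lenA: "length (eigvals A) = N" and lenB: "length (eigvals B) = b"
    by (rule length_eigvals[OF A(2)], rule length_eigvals[OF B(1)])
  obtain u where u_orth: "\<And>i j. i < N \<Longrightarrow> j < N \<Longrightarrow> (\<Sum>x<N. cnj (u i x) * u j x) = (if i = j then 1 else 0)"
    and "\<And>x y. x < N \<Longrightarrow> y < N \<Longrightarrow> (\<Sum>j<N. u j x * cnj (u j y)) = (if x = y then 1 else 0)"
    and u_A: "\<And>x y. x < N \<Longrightarrow> y < N \<Longrightarrow>
       A $$ (x, y) = (\<Sum>j<N. complex_of_real (eigvals A ! j) * (u j x * cnj (u j y)))"
    by (rule spectral_theorem[OF hA A(2)], rule that)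
  obtain e where e_orth: "\<And>i j. i < b \<Longrightarrow> j < b \<Longrightarrow> (\<Sum>x<b. cnj (e i x) * e j x) = (if i = j then 1 else 0)"
    and e_complete: "\<And>x y. x < b \<Longrightarrow> y < b \<Longrightarrow> (\<Sum>j<b. e j x * cnj (e j y)) = (if x = y then 1 else 0)"
    and e_B: "\<And>x y. x < b \<Longrightarrow> y < b \<Longrightarrow>
       B $$ (x, y) = (\<Sum>j<b. complex_of_real (eigvals B ! j) * (e j x * cnj (e j y)))"
    by (rule spectral_theorem[OF hB B(1)], rule that)
  define ev where "ev j = eigvals A ! j" for j
  define \<beta> where "\<beta> l = eigvals B ! l" for l
  \<comment> \<open>\<open>s j i l\<close> is the coefficient of \<open>u j\<close> at \<open>f\<^sub>i \<otimes> e l\<close>, with \<open>f\<^sub>i\<close> the \<open>i\<close>-th unit vector, and \<open>p j l\<close>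
    is the squared norm of the projection of \<open>u j\<close> to the span of the \<open>f\<^sub>i \<otimes> e l\<close>.\<close>
  define s where "s j i l = (\<Sum>k<b. cnj (e l k) * u j (\<phi> i k))" for j i l
  define p where "p j l = (\<Sum>i<a. (cmod (s j i l))\<^sup>2)" for j l
  have p0: "0 \<le> p j l" for j l by (simp add: p_def sum_nonneg)

  have A_form: "(\<Sum>x<N. \<Sum>y<N. cnj (z x) * A $$ (x, y) * z y) =
      complex_of_real (\<Sum>j<N. ev j * (cmod (\<Sum>x<N. cnj (u j x) * z x))\<^sup>2)" for z
    by (rule form_spectral) (simp add: u_A ev_def)
  have B_form: "(\<Sum>x<b. \<Sum>y<b. cnj (z x) * B $$ (x, y) * z y) =
      complex_of_real (\<Sum>l<b. \<beta> l * (cmod (\<Sum>x<b. cnj (e l x) * z x))\<^sup>2)" for z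
    by (rule form_spectral) (simp add: e_B \<beta>_def)

  have ev0: "0 \<le> ev j" if j: "j < N" for j
  proof -
    have "(\<Sum>j'<N. ev j' * (cmod (\<Sum>x<N. cnj (u j' x) * u j x))\<^sup>2) = (\<Sum>j'<N. if j' = j then ev j else 0)"
      using j by (intro sum.cong) (auto simp: u_orth)
    then show ?thesis
      using psd_form_nonneg[OF A, of "u j"] j unfolding A_form by (simp add: less_eq_complex_def)
  qed

  have p_row: "(\<Sum>l<b. p j l) = 1" if j: "j < N" for j
  proof -
    have "(\<Sum>l<b. p j l) = (\<Sum>i<a. \<Sum>l<b. (cmod (s j i l))\<^sup>2)"
      unfolding p_def by (rule sum.swap)
    also have "\<dots> = (\<Sum>i<a. \<Sum>k<b. (cmod (u j (\<phi> i k)))\<^sup>2)"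
      unfolding s_def using e_complete by (intro sum.cong refl parseval) auto
    finally have "complex_of_real (\<Sum>l<b. p j l) = (\<Sum>x<N. complex_of_real ((cmod (u j x))\<^sup>2))"
      unfolding sum_\<phi> by simp
    also have "\<dots> = (\<Sum>x<N. cnj (u j x) * u j x)"
      by (simp only: complex_norm_square mult.commute)
    finally show ?thesis using u_orth[OF j j] by (simp only: simp_thms if_True of_real_eq_1_iff)
  qed

  \<comment> \<open>Both sides are \<open>tr (A (I \<otimes> e l e l\<^sup>*))\<close>, computed in the eigenbasis of \<open>A\<close> and by taking the
    partial trace first.\<close>
  have p_col: "(\<Sum>j<N. ev j * p j l) = \<beta> l" if l: "l < b" for l
  proof -
    have "(\<Sum>l'<b. \<beta> l' * (cmod (\<Sum>x<b. cnj (e l' x) * e l x))\<^sup>2) = (\<Sum>l'<b. if l' = l then \<beta> l else 0)"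
      using l by (intro sum.cong) (auto simp: e_orth)
    then have "complex_of_real (\<beta> l) = (\<Sum>k<b. \<Sum>k'<b. cnj (e l k) * B $$ (k, k') * e l k')"
      unfolding B_form using l by simp
    also have "\<dots> = (\<Sum>k<b. \<Sum>k'<b. \<Sum>i<a. cnj (e l k) * A $$ (\<phi> i k, \<phi> i k') * e l k')"
      by (intro sum.cong refl) (simp add: B(2) sum_distrib_left sum_distrib_right)
    also have "\<dots> = (\<Sum>k<b. \<Sum>i<a. \<Sum>k'<b. cnj (e l k) * A $$ (\<phi> i k, \<phi> i k') * e l k')"
      by (intro sum.cong refl sum.swap)
    also have "\<dots> = (\<Sum>i<a. \<Sum>k<b. \<Sum>k'<b. cnj (e l k) * A $$ (\<phi> i k, \<phi> i k') * e l k')"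
      by (rule sum.swap)
    also have "\<dots> = (\<Sum>i<a. complex_of_real
        (\<Sum>j<N. ev j * (cmod (\<Sum>k<b. cnj (u j (\<phi> i k)) * e l k))\<^sup>2))"
      by (intro sum.cong refl form_spectral) (simp add: u_A ev_def \<phi>)
    also have "\<dots> = (\<Sum>i<a. complex_of_real (\<Sum>j<N. ev j * (cmod (s j i l))\<^sup>2))"
    proof -
      have "(\<Sum>k<b. cnj (u j (\<phi> i k)) * e l k) = cnj (s j i l)" for i j
        by (simp add: s_def mult.commute)
      then show ?thesis by simp
    qed
    also have "\<dots> = complex_of_real (\<Sum>j<N. ev j * p j l)"
      unfolding p_def sum_distrib_left of_real_sum by (rule sum.swap)
    finally show ?thesis by (simp only: of_real_eq_iff)
  qed
  have \<beta>0: "0 \<le> \<beta> l" if "l < b" for l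
    unfolding p_col[OF that, symmetric] using ev0 p0 by (intro sum_nonneg) auto

  \<comment> \<open>This is \<open>A \<le> I \<otimes> B\<close>.\<close>
  have reduction: "(\<Sum>x<N. \<Sum>y<N. cnj (z x) * A $$ (x, y) * z y) \<le>
      (\<Sum>i<a. \<Sum>k<b. \<Sum>l<b. cnj (z (\<phi> i k)) * B $$ (k, l) * z (\<phi> i l))" for z
  proof -
    let ?c = "\<lambda>i k j l. C $$ (\<phi> i k, \<phi> j l)"
    have "0 \<le> (\<Sum>i<a. \<Sum>k<b. \<Sum>j<a. \<Sum>l<b. cnj (y i k) * ?c i k j l * y j l)" for y
      using psd_form_nonneg[OF C, of "\<lambda>x. y (fst (coords x)) (snd (coords x))"]
      unfolding sum_\<phi> by (simp add: coords)
    from reduction_inequality[where c = ?c, OF this, of "\<lambda>i k. z (\<phi> i k)"]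
    show ?thesis unfolding sum_\<phi> by (simp add: CA B(2))
  qed

  \<comment> \<open>Evaluate the reduction inequality at \<open>z = (I \<otimes> B\<^sup>-\<^sup>1) (u j)\<close>. With
    \<open>q = (u j)\<^sup>* (I \<otimes> B\<^sup>-\<^sup>1) (u j)\<close> the right-hand side is \<open>q\<close>, while the left-hand side is at least
    the contribution \<open>ev j * q\<^sup>2\<close> of the eigenvector \<open>u j\<close>. The convention \<open>x / 0 = 0\<close> makes the
    inverse a pseudoinverse if \<open>B\<close> is singular.\<close>
  have p_div: "ev j * (\<Sum>l<b. p j l / \<beta> l) \<le> 1" if j: "j < N" for j
  proof -
    define q where "q = (\<Sum>l<b. p j l / \<beta> l)"
    have q0: "0 \<le> q" unfolding q_def using p0 \<beta>0 by (intro sum_nonneg) auto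
    define z where "z x = (\<Sum>l<b. s j (fst (coords x)) l / \<beta> l * e l (snd (coords x)))" for x
    have z: "z (\<phi> i k) = (\<Sum>l<b. s j i l / \<beta> l * e l k)" if "i < a" "k < b" for i k
      using that by (simp add: z_def coords)
    have ez: "(\<Sum>k<b. cnj (e l k) * z (\<phi> i k)) = s j i l / \<beta> l" if i: "i < a" and l: "l < b" for i l
    proof -
      have "(\<Sum>k<b. cnj (e l k) * z (\<phi> i k)) = (\<Sum>k<b. \<Sum>l'<b. s j i l' / \<beta> l' * (cnj (e l k) * e l' k))"
        by (intro sum.cong refl) (simp add: z i sum_distrib_left mult_ac)
      also have "\<dots> = (\<Sum>l'<b. \<Sum>k<b. s j i l' / \<beta> l' * (cnj (e l k) * e l' k))" by (rule sum.swap)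
      also have "\<dots> = (\<Sum>l'<b. if l = l' then s j i l / \<beta> l else 0)"
        using l by (intro sum.cong refl, unfold sum_distrib_left[symmetric]) (auto simp: e_orth)
      finally show ?thesis using l by simp
    qed
    have "(\<Sum>i<a. \<Sum>k<b. \<Sum>l<b. cnj (z (\<phi> i k)) * B $$ (k, l) * z (\<phi> i l)) =
        complex_of_real (\<Sum>i<a. \<Sum>l<b. \<beta> l * (cmod (s j i l / \<beta> l))\<^sup>2)"
      unfolding B_form by (simp add: ez)
    also have "(\<Sum>i<a. \<Sum>l<b. \<beta> l * (cmod (s j i l / \<beta> l))\<^sup>2) = (\<Sum>i<a. \<Sum>l<b. (cmod (s j i l))\<^sup>2 / \<beta> l)"
      by (intro sum.cong refl) (simp add: norm_divide power_divide power2_eq_square)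
    also have "\<dots> = q"
      unfolding q_def p_def sum_divide_distrib by (rule sum.swap)
    finally have Bz: "(\<Sum>i<a. \<Sum>k<b. \<Sum>l<b. cnj (z (\<phi> i k)) * B $$ (k, l) * z (\<phi> i l)) = complex_of_real q" .
    have "(\<Sum>x<N. cnj (u j x) * z x) = (\<Sum>i<a. \<Sum>k<b. \<Sum>l<b. s j i l / \<beta> l * cnj (cnj (e l k) * u j (\<phi> i k)))"
      unfolding sum_\<phi> by (intro sum.cong refl) (simp add: z sum_distrib_left mult_ac)
    also have "\<dots> = (\<Sum>i<a. \<Sum>l<b. \<Sum>k<b. s j i l / \<beta> l * cnj (cnj (e l k) * u j (\<phi> i k)))"
      by (intro sum.cong refl sum.swap)
    also have "\<dots> = (\<Sum>i<a. \<Sum>l<b. s j i l / \<beta> l * cnj (s j i l))"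
      unfolding s_def[of j _ _, symmetric] cnj_sum[symmetric] sum_distrib_left[symmetric] ..
    also have "\<dots> = (\<Sum>i<a. \<Sum>l<b. complex_of_real ((cmod (s j i l))\<^sup>2 / \<beta> l))"
      by (simp add: complex_norm_square[symmetric] flip: of_real_power)
    also have "\<dots> = (\<Sum>l<b. \<Sum>i<a. complex_of_real ((cmod (s j i l))\<^sup>2 / \<beta> l))" by (rule sum.swap)
    also have "\<dots> = complex_of_real q"
      by (simp add: q_def p_def sum_divide_distrib)
    finally have uz: "(\<Sum>x<N. cnj (u j x) * z x) = complex_of_real q" .
    have "ev j * q\<^sup>2 \<le> (\<Sum>j'<N. ev j' * (cmod (\<Sum>x<N. cnj (u j' x) * z x))\<^sup>2)"
      using member_le_sum[of j "{..<N}" "\<lambda>j'. ev j' * (cmod (\<Sum>x<N. cnj (u j' x) * z x))\<^sup>2"] j ev0 uz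
      by simp
    also have "\<dots> \<le> q"
      using reduction[of z] unfolding A_form Bz by (simp add: less_eq_complex_def)
    finally have "(ev j * q) * q \<le> 1 * q" by (simp add: power2_eq_square mult_ac)
    then show ?thesis
      using q0 unfolding q_def[symmetric] by (cases "q = 0") (auto simp: mult_le_cancel_right)
  qed

  show ?thesis
  proof (rule majorized_if_substochastic[where w = "\<lambda>j l. ev j * p j l / \<beta> l"], unfold lenA lenB)
    fix j assume j: "j < N"
    show "(\<Sum>l<b. ev j * p j l / \<beta> l) \<le> 1"
      using p_div[OF j] by (simp add: sum_distrib_left)
    \<comment> \<open>Division by \<open>\<beta> l = 0\<close> loses nothing: the nonnegative terms of \<open>p_col\<close> then all vanish.\<close>
    have "ev j * p j l / \<beta> l * \<beta> l = ev j * p j l" if l: "l < b" for l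
    proof (cases "\<beta> l = 0")
      case True
      have "ev j * p j l \<le> 0"
        using member_le_sum[of j "{..<N}" "\<lambda>j. ev j * p j l"] p_col[OF l] j ev0 p0 True by simp
      moreover have "0 \<le> ev j * p j l" using ev0[OF j] p0 by simp
      ultimately have "ev j * p j l = 0" by (rule antisym)
      then show ?thesis by simp
    qed simp
    then have "(\<Sum>l<b. ev j * p j l / \<beta> l * \<beta> l) = ev j * (\<Sum>l<b. p j l)"
      by (simp add: sum_distrib_left)
    then show "eigvals A ! j = (\<Sum>l<b. ev j * p j l / \<beta> l * eigvals B ! l)"
      using p_row[OF j] by (simp add: ev_def \<beta>_def)
  next
    fix l assume l: "l < b"
    show "(\<Sum>j<N. ev j * p j l / \<beta> l) \<le> 1"
      using p_col[OF l] by (simp flip: sum_divide_distrib)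
    show "0 \<le> eigvals B ! l" using \<beta>0[OF l] by (simp add: \<beta>_def)
  next
    have "(\<Sum>j<N. ev j) = (\<Sum>j<N. \<Sum>l<b. ev j * p j l)"
      by (simp add: p_row flip: sum_distrib_left)
    also have "\<dots> = (\<Sum>l<b. \<Sum>j<N. ev j * p j l)" by (rule sum.swap)
    also have "\<dots> = (\<Sum>l<b. \<beta> l)" using p_col by simp
    finally show "(\<Sum>j<N. eigvals A ! j) = (\<Sum>l<b. eigvals B ! l)" by (simp add: ev_def \<beta>_def)
  qed (use bN ev0 p0 \<beta>0 sorted_rev_eigvals in \<open>auto simp: ev_def \<beta>_def\<close>)
qed

lemma bij_betw_block_index:
  fixes m n :: nat
  shows "bij_betw (\<lambda>(i, k). i * n + k) ({..<m} \<times> {..<n}) {..<m * n}"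
  by (rule bij_betw_byWitness[where f' = "\<lambda>x. (x div n, x mod n)"])
    (auto simp: block_index_less less_mult_imp_div_less intro!: mod_less_divisor gr0I)

lemma bij_betw_block_index_swap:
  fixes m n :: nat
  shows "bij_betw (\<lambda>(k, i). i * n + k) ({..<n} \<times> {..<m}) {..<m * n}"
  by (rule bij_betw_byWitness[where f' = "\<lambda>x. (x mod n, x div n)"])
    (auto simp: block_index_less less_mult_imp_div_less intro!: mod_less_divisor gr0I)

lemma partial_transpose_carrier: "partial_transpose m n A \<in> carrier_mat (m * n) (m * n)"
  by (simp add: partial_transpose_def mat_of_blocks_def)

lemma partial_transpose_index:
  assumes "i < m" "j < m" "k < n" "l < n"
  shows "partial_transpose m n A $$ (i * n + k, j * n + l) = A $$ (j * n + k, i * n + l)"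
  using assms by (simp add: partial_transpose_def mat_of_blocks_def block_def block_index_less)

lemma eigvals_transpose: "A \<in> carrier_mat n n \<Longrightarrow> eigvals (transpose_mat A) = eigvals A"
  by (simp add: eigvals_def)

theorem theorem6p2:
  fixes m n :: nat and A :: "complex mat"
  assumes "m \<ge> 1" and "n \<ge> 1"
    and "A \<in> carrier_mat (m * n) (m * n)"
    and "ppt m n A"
  shows "eigvals A \<prec>\<^sub>m eigvals (partial_trace1 m n A) \<and>
         eigvals A \<prec>\<^sub>m eigvals (partial_trace2 m n A) \<and>
         eigvals (partial_transpose m n A) \<prec>\<^sub>m eigvals (partial_trace1 m n A) \<and>
         eigvals (partial_transpose m n A) \<prec>\<^sub>m eigvals (partial_trace2 m n A)"
proof -
  let ?T = "partial_transpose m n A"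
  have m: "0 < m" and n: "0 < n" using assms by auto
  have A: "psd A" "A \<in> carrier_mat (m * n) (m * n)" and T: "psd ?T" "?T \<in> carrier_mat (m * n) (m * n)"
    using assms partial_transpose_carrier by (auto simp: ppt_def)
  have A': "psd (transpose_mat A)" "transpose_mat A \<in> carrier_mat (m * n) (m * n)"
    and T': "psd (transpose_mat ?T)" "transpose_mat ?T \<in> carrier_mat (m * n) (m * n)"
    using A T psd_transpose by auto
  have tr2: "partial_trace2 m n A \<in> carrier_mat m m" by (simp add: partial_trace2_def)
  \<comment> \<open>\<open>A\<close> and \<open>A\<^sup>\<tau>\<close> have the same \<open>tr\<^sub>1\<close> and are partial transposes of each other.\<close>
  have "eigvals A \<prec>\<^sub>m eigvals (partial_trace1 m n A)"
    using m bij_betw_block_index A T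
    by (rule majorized_by_partial_trace)
      (auto simp: partial_transpose_index partial_trace1_def block_def)
  moreover have "eigvals ?T \<prec>\<^sub>m eigvals (partial_trace1 m n A)"
    using m bij_betw_block_index T A
    by (rule majorized_by_partial_trace)
      (auto simp: partial_transpose_index partial_trace1_def block_def)
  \<comment> \<open>Transposing \<open>A\<close> only inside the blocks is the full transpose of \<open>A\<^sup>\<tau>\<close>.\<close>
  moreover have "eigvals A \<prec>\<^sub>m eigvals (partial_trace2 m n A)"
    using n bij_betw_block_index_swap A T'
    by (rule majorized_by_partial_trace)
      (use T in \<open>auto simp: partial_transpose_index partial_trace2_def block_def mat_trace_def block_index_less\<close>)
  \<comment> \<open>The entries of \<open>tr\<^sub>2 A\<^sup>\<tau>\<close> are the traces of the blocks of \<open>A\<close> in exchanged positions.\<close>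
  moreover have "eigvals ?T \<prec>\<^sub>m eigvals (transpose_mat (partial_trace2 m n A))"
    using n bij_betw_block_index_swap T A'
    by (rule majorized_by_partial_trace)
      (use A in \<open>auto simp: partial_transpose_index partial_trace2_def block_def mat_trace_def block_index_less\<close>)
  ultimately show ?thesis using eigvals_transpose[OF tr2] by simp
qed

end
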